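(* Let $c$ be a vector of $d$ non-negative integers, let $k \in \mathbb{N}_+$ be a sparsity, $b \in \mathbb{N}_+$ a block size and $\Delta \in \mathbb{N}_+$. Define $c^b \in \mathbb{Z}^{d-b+1}$ by $c^b_i := \sum_{j=i}^{i+b-1} c_j$. Let $S$ be a set of indices corresponding to an optimal solution of the $(\Delta + b - 1)$-separated problem for cost vector $c^b$ and sparsity $k$. Then $S$ is an optimal solution of the $(\Delta, b)$-separated problem for cost vector $c$ and sparsity $k$.
   Context: For a cost vector $a \in \mathbb{R}^{n}$, sparsity $k$ and separation $D$, the $D$-separated problem asks for a set $S \subseteq \{1,\dots,n\}$ with $|S| = k$ and $|i - j| \ge D$ for all distinct $i,j \in S$ maximizing $\sum_{i\in S} a_i$. The $(\Delta,b)$-separated problem for $c \in \mathbb{R}^d$ and sparsity $k$ asks for $k$ indices $p_1,\dots,p_k$ with $1 \le p_i \le d - b + 1$ for all $i$, $|p_i - p_j| \ge \Delta + b - 1$ for all $i \neq j$, maximizing $\sum_{i=1}^k \sum_{j=0}^{b-1} c_{p_i + j}$. *)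

theory Defs
  imports Complex_Main
begin

text \<open>
  A vector of dimension \<open>n\<close> is a function on \<open>nat\<close> of which only the values at \<open>1, \<dots>, n\<close> matter.
\<close>

definition separated_feasible :: "nat \<Rightarrow> nat \<Rightarrow> nat \<Rightarrow> nat set \<Rightarrow> bool" where
  "separated_feasible n k D S \<longleftrightarrow>
     S \<subseteq> {1..n} \<and> card S = k \<and>
     (\<forall>i\<in>S. \<forall>j\<in>S. i \<noteq> j \<longrightarrow> \<bar>int i - int j\<bar> \<ge> int D)"

definition separated_optimal :: "(nat \<Rightarrow> real) \<Rightarrow> nat \<Rightarrow> nat \<Rightarrow> nat \<Rightarrow> nat set \<Rightarrow> bool" where
  "separated_optimal a n k D S \<longleftrightarrow>
     is_arg_max (\<lambda>T. \<Sum>i\<in>T. a i) (separated_feasible n k D) S"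

text \<open>
  A candidate solution of the block problem is a tuple \<open>p 1, \<dots>, p k\<close>; the values of \<open>p\<close>
  outside \<open>{1..k}\<close> are irrelevant.
\<close>

definition block_feasible :: "nat \<Rightarrow> nat \<Rightarrow> nat \<Rightarrow> nat \<Rightarrow> (nat \<Rightarrow> nat) \<Rightarrow> bool" where
  "block_feasible d k \<Delta> b p \<longleftrightarrow>
     (\<forall>i\<in>{1..k}. 1 \<le> p i \<and> int (p i) \<le> int d - int b + 1) \<and>
     (\<forall>i\<in>{1..k}. \<forall>j\<in>{1..k}. i \<noteq> j \<longrightarrow>
        \<bar>int (p i) - int (p j)\<bar> \<ge> int \<Delta> + int b - 1)"

definition block_optimal ::
    "(nat \<Rightarrow> real) \<Rightarrow> nat \<Rightarrow> nat \<Rightarrow> nat \<Rightarrow> nat \<Rightarrow> (nat \<Rightarrow> nat) \<Rightarrow> bool" where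
  "block_optimal c d k \<Delta> b p \<longleftrightarrow>
     is_arg_max (\<lambda>q. \<Sum>i=1..k. \<Sum>j<b. c (q i + j)) (block_feasible d k \<Delta> b) p"

text \<open>
  A set solves the block problem if its elements are the \<open>k\<close> indices of an optimal tuple.
  Both the constraints and the objective are invariant under reordering the tuple.
\<close>

definition block_optimal_set ::
    "(nat \<Rightarrow> real) \<Rightarrow> nat \<Rightarrow> nat \<Rightarrow> nat \<Rightarrow> nat \<Rightarrow> nat set \<Rightarrow> bool" where
  "block_optimal_set c d k \<Delta> b S \<longleftrightarrow>
     (\<exists>p. bij_betw p {1..k} S \<and> block_optimal c d k \<Delta> b p)"

definition block_sums :: "(nat \<Rightarrow> int) \<Rightarrow> nat \<Rightarrow> nat \<Rightarrow> int" where
  "block_sums c b i = (\<Sum>j\<in>{i..<i + b}. c j)"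

end

theory Submission
  imports Defs
begin

text \<open>
  Enumerating a set of \<open>k\<close> indices gives a tuple with the same constraints and the same objective,
  since the separation \<open>\<Delta> + b - 1\<close> is positive and hence forces the entries of a feasible tuple
  to be distinct. So the two problems have the same solutions.
\<close>

text \<open>Lets an arbitrary competing tuple be replaced by its image, which then has exactly
  \<open>k\<close> elements.\<close>

lemma block_feasible_inj_on:
  assumes "0 < b" and "0 < \<Delta>" and "block_feasible d k \<Delta> b p"
  shows "inj_on p {1..k}"
proof (rule inj_onI, rule ccontr)
  fix i j
  assume "i \<in> {1..k}" "j \<in> {1..k}" "p i = p j" "i \<noteq> j"
  then have "int \<Delta> + int b - 1 \<le> \<bar>int (p i) - int (p j)\<bar>"
    using assms(3) unfolding block_feasible_def by blast
  then show False
    using \<open>p i = p j\<close> assms(1,2) by simp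
qed

text \<open>A bijection carries pairs of distinct positions to pairs of distinct elements, so the
  pairwise constraints match one by one.\<close>

lemma block_feasible_iff_separated_feasible:
  assumes "0 < b" and "bij_betw p {1..k} S"
  shows "block_feasible d k \<Delta> b p \<longleftrightarrow> separated_feasible (d + 1 - b) k (\<Delta> + b - 1) S"
proof -
  have inj: "inj_on p {1..k}" and S: "S = p ` {1..k}"
    using assms(2) by (auto simp: bij_betw_def)
  have card: "card S = k"
    using bij_betw_same_card[OF assms(2)] by simp
  \<comment> \<open>The subtraction on \<open>nat\<close> is exact because \<open>b\<close> is at
    least 1.\<close>
  have D: "int (\<Delta> + b - 1) = int \<Delta> + int b - 1"
    using assms(1) by linarith
  \<comment> \<open>If \<open>b > d + 1\<close>, the natural subtraction truncates to 0 while the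
    integer bound is negative; no \<open>x\<close> satisfies either side.\<close>
  have range: "1 \<le> x \<and> int x \<le> int d - int b + 1 \<longleftrightarrow> x \<in> {1..d + 1 - b}" for x
    by auto
  have "(\<forall>i\<in>S. \<forall>j\<in>S. i \<noteq> j \<longrightarrow> \<bar>int i - int j\<bar> \<ge> int (\<Delta> + b - 1)) \<longleftrightarrow>
      (\<forall>i\<in>{1..k}. \<forall>j\<in>{1..k}. i \<noteq> j \<longrightarrow> \<bar>int (p i) - int (p j)\<bar> \<ge> int \<Delta> + int b - 1)"
    unfolding S D ball_simps using inj_on_eq_iff[OF inj] by blast
  moreover have "(\<forall>i\<in>{1..k}. 1 \<le> p i \<and> int (p i) \<le> int d - int b + 1) \<longleftrightarrow> S \<subseteq> {1..d + 1 - b}"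
    unfolding S range by blast
  ultimately show ?thesis
    unfolding block_feasible_def separated_feasible_def using card by blast
qed

text \<open>Shifting the inner index by the block start \<open>x\<close> turns
  \<open>{0..<b}\<close> into \<open>{x..<x + b}\<close>; the outer sum is then reindexed along
  \<open>p\<close>.\<close>

lemma block_objective_eq_sum_block_sums:
  assumes "bij_betw p {1..k} S"
  shows "(\<Sum>i=1..k. \<Sum>j<b. real_of_int (c (p i + j))) = (\<Sum>x\<in>S. real_of_int (block_sums c b x))"
proof -
  have "(\<Sum>j<b. real_of_int (c (x + j))) = real_of_int (block_sums c b x)" for x
    using sum.shift_bounds_nat_ivl[of c 0 x b]
    by (simp add: block_sums_def atLeast0LessThan add.commute flip: of_int_sum)
  then show ?thesis
    using sum.reindex_bij_betw[OF assms, of "\<lambda>x. real_of_int (block_sums c b x)"] by simp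
qed

theorem theorem7:
  fixes c :: "nat \<Rightarrow> int" and d k b \<Delta> :: nat and S :: "nat set"
  assumes "\<forall>i\<in>{1..d}. 0 \<le> c i"
    and "0 < k" and "0 < b" and "0 < \<Delta>"
    and "separated_optimal (\<lambda>i. real_of_int (block_sums c b i)) (d + 1 - b) k (\<Delta> + b - 1) S"
  shows "block_optimal_set (\<lambda>i. real_of_int (c i)) d k \<Delta> b S"
proof -
  let ?feas = "separated_feasible (d + 1 - b) k (\<Delta> + b - 1)"
  let ?val = "\<lambda>T. \<Sum>x\<in>T. real_of_int (block_sums c b x)"
  have opt: "?val T \<le> ?val S" if "?feas T" for T
    using assms(5) that by (auto simp: separated_optimal_def is_arg_max_linorder)
  have feasS: "?feas S"
    using assms(5) by (simp add: separated_optimal_def is_arg_max_def)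
  then have "finite S" "card S = k"
    by (auto simp: separated_feasible_def intro: finite_subset)
  \<comment> \<open>Any enumeration of \<open>S\<close> will do, since feasibility and objective
    depend only on the image of a bijection.\<close>
  then obtain p where p: "bij_betw p {1..k} S"
    using ex_bij_betw_nat_finite_1 by blast
  \<comment> \<open>The image of a competitor \<open>q\<close> is a feasible set, so the optimality
    of \<open>S\<close> bounds its value, which is the objective of \<open>q\<close>.\<close>
  have "(\<Sum>i=1..k. \<Sum>j<b. real_of_int (c (q i + j))) \<le> (\<Sum>i=1..k. \<Sum>j<b. real_of_int (c (p i + j)))"
    if q: "block_feasible d k \<Delta> b q" for q
  proof -
    have bij: "bij_betw q {1..k} (q ` {1..k})"
      using block_feasible_inj_on[OF assms(3,4) q] by (rule inj_on_imp_bij_betw)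
    have "?feas (q ` {1..k})"
      using block_feasible_iff_separated_feasible[OF assms(3) bij] q by blast
    then show ?thesis
      using opt block_objective_eq_sum_block_sums[OF bij] block_objective_eq_sum_block_sums[OF p]
      by simp
  qed
  moreover have "block_feasible d k \<Delta> b p"
    using block_feasible_iff_separated_feasible[OF assms(3) p] feasS by blast
  ultimately show ?thesis
    unfolding block_optimal_set_def block_optimal_def is_arg_max_linorder using p by blast
qed

end
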